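(* Let $a<b$ and $0<\alpha<1$, let $f:[a,b]\times\mathbb{R}\to\mathbb{R}$ be a smooth function, let $h_1,h_2:[a,b]\to\mathbb{R}$ be functions, and let $\lambda_1,\lambda_2<0$ be real numbers such that $$\lambda_2 w(t)+h_2(t)\ \le\ f(t,w(t))\ \le\ \lambda_1 w(t)+h_1(t)\qquad\text{for all } t\in(a,b)\text{ and all } w\in H^1(a,b).$$ Let $u\in H^1(a,b)$ be a solution of $$({}^{ABC}{}_{a}D^\alpha u)(t)=f(t,u(t)),\qquad t\in(a,b],$$ and let $v_1,v_2\in H^1(a,b)$ be solutions of $$({}^{ABC}{}_{a}D^\alpha v_1)(t)=\lambda_1 v_1(t)+h_1(t),\qquad ({}^{ABC}{}_{a}D^\alpha v_2)(t)=\lambda_2 v_2(t)+h_2(t),\qquad t\in(a,b].$$ Then $v_2(t)\le u(t)\le v_1(t)$ for all $t\in[a,b]$.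
   Context: All functions are real-valued; a function in the Sobolev space $H^1(a,b)$ is identified with its continuous representative on $[a,b]$. $E_\alpha(z)=\sum_{k\ge 0} z^k/\Gamma(\alpha k+1)$ is the Mittag-Leffler function, and $B$ is a normalization function with $B(\alpha)>0$ and $B(0)=B(1)=1$. For $u\in H^1(a,b)$ and $\alpha\in(0,1)$, the left Caputo fractional derivative with Mittag-Leffler non-singular kernel is $$({}^{ABC}{}_{a}D^\alpha u)(t)=\frac{B(\alpha)}{1-\alpha}\int_a^t E_\alpha\!\left[-\frac{\alpha}{1-\alpha}(t-s)^\alpha\right] u'(s)\,ds,\qquad t\in[a,b].$$ *)

theory Defs
  imports "HOL-Analysis.Analysis"
begin

text \<open>
  Derivatives are taken relative to \<open>S\<close>, hence one-sided at boundary points. For \<open>S = {a..b} \<times> UNIV\<close>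
  with \<open>a < b\<close> they are uniquely determined, so the choice of \<open>f'\<close> is immaterial and smoothness is
  smoothness up to the boundary.
\<close>

primrec Ck_on :: "nat \<Rightarrow> 'a::real_normed_vector set \<Rightarrow> ('a \<Rightarrow> 'b::real_normed_vector) \<Rightarrow> bool" where
  "Ck_on 0 S f \<longleftrightarrow> continuous_on S f"
| "Ck_on (Suc k) S f \<longleftrightarrow>
     (\<exists>f'. (\<forall>x\<in>S. (f has_derivative f' x) (at x within S)) \<and> (\<forall>v. Ck_on k S (\<lambda>x. f' x v)))"

definition smooth_on :: "'a::real_normed_vector set \<Rightarrow> ('a \<Rightarrow> 'b::real_normed_vector) \<Rightarrow> bool" where
  "smooth_on S f \<longleftrightarrow> (\<forall>k. Ck_on k S f)"

definition test_functions :: "real \<Rightarrow> real \<Rightarrow> (real \<Rightarrow> real) set" where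
  "test_functions a b =
     {\<phi>. smooth_on UNIV \<phi> \<and> compact (closure {x. \<phi> x \<noteq> 0}) \<and> closure {x. \<phi> x \<noteq> 0} \<subseteq> {a<..<b}}"

definition square_integrable :: "real \<Rightarrow> real \<Rightarrow> (real \<Rightarrow> real) \<Rightarrow> bool" where
  "square_integrable a b g \<longleftrightarrow>
     set_borel_measurable lborel {a<..<b} g \<and> set_integrable lborel {a<..<b} (\<lambda>x. (g x)\<^sup>2)"

definition has_weak_deriv :: "real \<Rightarrow> real \<Rightarrow> (real \<Rightarrow> real) \<Rightarrow> (real \<Rightarrow> real) \<Rightarrow> bool" where
  "has_weak_deriv a b u g \<longleftrightarrow>
     (\<forall>\<phi>\<in>test_functions a b.
        (LINT x:{a<..<b}|lborel. u x * deriv \<phi> x) = - (LINT x:{a<..<b}|lborel. g x * \<phi> x))"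

text \<open>
  Members of \<open>H1 a b\<close> are the continuous representatives on \<open>{a..b}\<close>; values outside \<open>{a..b}\<close> are
  unconstrained and irrelevant.
\<close>

definition H1 :: "real \<Rightarrow> real \<Rightarrow> (real \<Rightarrow> real) set" where
  "H1 a b =
     {u. continuous_on {a..b} u \<and> square_integrable a b u \<and>
         (\<exists>g. square_integrable a b g \<and> has_weak_deriv a b u g)}"

text \<open>
  The weak derivative is unique up to a null set of \<open>{a<..<b}\<close>, so integrals of \<open>weak_deriv a b u\<close>
  over subsets of \<open>{a..b}\<close> do not depend on the choice.
\<close>

definition weak_deriv :: "real \<Rightarrow> real \<Rightarrow> (real \<Rightarrow> real) \<Rightarrow> real \<Rightarrow> real" where
  "weak_deriv a b u = (SOME g. square_integrable a b g \<and> has_weak_deriv a b u g)"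

definition mittag_leffler :: "real \<Rightarrow> real \<Rightarrow> real" where
  "mittag_leffler \<alpha> z = (\<Sum>k. z ^ k / Gamma (\<alpha> * real k + 1))"

definition normalization_function :: "(real \<Rightarrow> real) \<Rightarrow> bool" where
  "normalization_function B \<longleftrightarrow> (\<forall>\<alpha>\<in>{0..1}. B \<alpha> > 0) \<and> B 0 = 1 \<and> B 1 = 1"

text \<open>
  The interval \<open>{a<..<t}\<close> differs from \<open>{a..t}\<close> by a null set; the endpoints are left out because
  \<open>weak_deriv a b u\<close> is only meaningful on \<open>{a<..<b}\<close>. The argument \<open>b\<close> is needed since \<open>u'\<close> is the
  weak derivative on \<open>{a<..<b}\<close>.
\<close>

definition abc_deriv ::
  "(real \<Rightarrow> real) \<Rightarrow> real \<Rightarrow> real \<Rightarrow> real \<Rightarrow> (real \<Rightarrow> real) \<Rightarrow> real \<Rightarrow> real" where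
  "abc_deriv B a b \<alpha> u t =
     B \<alpha> / (1 - \<alpha>) *
     (LINT s:{a<..<t}|lborel.
        mittag_leffler \<alpha> (- (\<alpha> / (1 - \<alpha>)) * (t - s) powr \<alpha>) * weak_deriv a b u s)"

end

theory Submission
  imports Defs "HOL-Computational_Algebra.Polynomial" "HOL-Real_Asymp.Real_Asymp"
begin

text \<open>
  The function \<open>x \<mapsto> E\<^sub>\<alpha>(-x)\<close> is nonnegative and decreasing on the nonnegative reals: at
  \<open>\<epsilon> = x n powr (-\<alpha>)\<close> it is the limit of the coefficients of \<open>z ^ n\<close> in
  \<open>(1 - z) powr (\<alpha> - 1) / ((1 - z) powr \<alpha> + \<epsilon>)\<close>, and these are nonnegative and decreasing in \<open>\<epsilon>\<close>
  because \<open>1 - (1 - z) powr \<alpha>\<close> has nonnegative coefficients. Hence the kernel of the fractional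
  derivative increases in \<open>s\<close> from a nonnegative value to \<open>1\<close>, and the second mean value theorem
  shows that for a difference \<open>w\<close> of two functions in \<open>H1 a b\<close> the derivative at \<open>t\<close> is a positive
  multiple of \<open>w t - w c\<close> for some \<open>c \<in> {a..t}\<close>. If it is also at least \<open>\<lambda> w t\<close> with \<open>\<lambda> < 0\<close>, then
  \<open>w\<close> has no negative minimum, neither in the interior nor, letting \<open>t \<rightarrow> a\<close>, at \<open>a\<close>.
\<close>

section \<open>Positivity and monotonicity of the Mittag-Leffler function\<close>

text \<open>The coefficient of \<open>z ^ n\<close> in \<open>(1 - z) powr (- s)\<close>.\<close>

definition binom_coeff :: "real \<Rightarrow> nat \<Rightarrow> real" where
  "binom_coeff s n = pochhammer s n / fact n"

lemma binom_coeff_0 [simp]: "binom_coeff s 0 = 1"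
  by (simp add: binom_coeff_def)

lemma binom_coeff_Suc: "binom_coeff s (Suc n) = binom_coeff s n * ((s + real n) / (real n + 1))"
  by (simp add: binom_coeff_def pochhammer_Suc field_simps)

lemma binom_coeff_nonneg: "s \<ge> 0 \<Longrightarrow> binom_coeff s n \<ge> 0"
  by (induction n) (simp_all add: binom_coeff_Suc)

text \<open>From \<open>n = 1\<close> on, the ratio \<open>(n - s) / (n + 1)\<close> of consecutive
  coefficients is nonnegative, so the sign of the first one, \<open>- s\<close>, persists. Hence
  \<open>1 - (1 - z) powr s\<close> has nonnegative coefficients.\<close>

lemma binom_coeff_neg:
  assumes "0 < s" "s < 1" "n \<ge> 1"
  shows "binom_coeff (- s) n \<le> 0"
  using assms(3)
proof (induction n rule: nat_induct_at_least)
  case base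
  then show ?case using assms by (simp add: binom_coeff_def)
next
  case (Suc n)
  then show ?case using assms
    unfolding binom_coeff_Suc by (intro mult_nonpos_nonneg) auto
qed

text \<open>Cauchy product of the series of \<open>(1 - z) powr (- s)\<close> and
  \<open>(1 - z) powr (- t)\<close>, that is, Vandermonde's identity for rising factorials.\<close>

lemma binom_coeff_add: "binom_coeff (s + t) n = (\<Sum>k\<le>n. binom_coeff s k * binom_coeff t (n - k))"
proof -
  have "binom_coeff (s + t) n =
      (\<Sum>k\<le>n. real (n choose k) * pochhammer s k * pochhammer t (n - k) / fact n)"
    by (simp add: binom_coeff_def pochhammer_binomial_sum sum_divide_distrib)
  also have "\<dots> = (\<Sum>k\<le>n. binom_coeff s k * binom_coeff t (n - k))"
    by (intro sum.cong) (auto simp: binom_coeff_def binomial_fact field_simps)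
  finally show ?thesis .
qed

section \<open>Growth and asymptotics of the binomial coefficients\<close>

text \<open>Each ratio \<open>1 + c / (n + 1)\<close> is at most \<open>1 + c\<close>. For fixed
  \<open>n\<close> the bound is polynomial in \<open>c\<close>, so with
  \<open>c = \<alpha> * j\<close> a geometric factor in \<open>j\<close> makes it summable.\<close>

lemma binom_coeff_le_power:
  assumes "c \<ge> 0"
  shows "binom_coeff (c + 1) n \<le> (1 + c) ^ n"
proof (induction n)
  case (Suc n)
  have "(c + 1 + real n) / (real n + 1) \<le> 1 + c"
    using assms by (simp add: field_simps)
  then have "binom_coeff (c + 1) n * ((c + 1 + real n) / (real n + 1)) \<le> (1 + c) ^ n * (1 + c)"
    using assms Suc by (intro mult_mono) auto
  then show ?case
    by (simp add: binom_coeff_Suc mult.commute)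
qed simp

text \<open>Combines \<open>1 + y \<le> exp y\<close> with
  \<open>1 / (n + 1) \<le> ln (n + 1) - ln n\<close>. It is the induction step for comparing the
  coefficients with \<open>n powr c\<close>.\<close>

lemma powr_ratio_lower:
  fixes c :: real
  assumes "c \<ge> 0" "n \<ge> (1::nat)"
  shows "real n powr c * ((c + 1 + real n) / (real n + 1)) \<le> real (Suc n) powr c"
proof -
  have "ln (real n / (real n + 1)) \<le> real n / (real n + 1) - 1"
    using assms by (intro ln_le_minus_one) auto
  then have l: "1 / (real n + 1) \<le> ln (real n + 1) - ln (real n)"
    using assms by (simp add: ln_div field_simps)
  have "(c + 1 + real n) / (real n + 1) = 1 + c * (1 / (real n + 1))"
    by (simp add: field_simps)
  also have "\<dots> \<le> 1 + c * (ln (real n + 1) - ln (real n))"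
    using mult_left_mono[OF l assms(1)] by simp
  also have "\<dots> \<le> exp (c * (ln (real n + 1) - ln (real n)))"
    by (rule exp_ge_add_one_self)
  finally have "real n powr c * ((c + 1 + real n) / (real n + 1)) \<le>
      real n powr c * exp (c * (ln (real n + 1) - ln (real n)))"
    by (intro mult_left_mono) auto
  also have "\<dots> = real (Suc n) powr c"
    using assms by (simp add: powr_def algebra_simps flip: exp_add)
  finally show ?thesis .
qed

text \<open>The crude bound is used up to index \<open>k\<close> and the ratio bound from there on.
  Keeping \<open>k\<close> free gives growth \<open>n powr c\<close> with a constant whose
  dependence on \<open>c\<close> is explicit, as a majorant uniform in \<open>n\<close>
  requires.\<close>

lemma binom_coeff_le:
  assumes "c \<ge> 0" "1 \<le> k" "k \<le> n"
  shows "binom_coeff (c + 1) n \<le> (1 + c) ^ k * (real n powr c / real k powr c)"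
  using assms(3)
proof (induction n rule: dec_induct)
  case base
  then show ?case using binom_coeff_le_power[of c k] assms by simp
next
  case (step n)
  have "binom_coeff (c + 1) (Suc n) = binom_coeff (c + 1) n * ((c + 1 + real n) / (real n + 1))"
    by (simp add: binom_coeff_Suc)
  also have "\<dots> \<le> ((1 + c) ^ k * (real n powr c / real k powr c)) * ((c + 1 + real n) / (real n + 1))"
    using step.IH assms by (intro mult_right_mono) auto
  also have "\<dots> = (1 + c) ^ k / real k powr c * (real n powr c * ((c + 1 + real n) / (real n + 1)))"
    by simp
  also have "\<dots> \<le> (1 + c) ^ k / real k powr c * (real (Suc n) powr c)"
    using assms step powr_ratio_lower[of c n] by (intro mult_left_mono) auto
  finally show ?case by (simp add: field_simps)
qed

text \<open>Euler's limit formula for \<open>1 / Gamma\<close>; the factor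
  \<open>n / (n + c + 1)\<close>, which tends to 1, removes the extra last factor of the Pochhammer
  symbol in \<open>rGamma_series\<close>.\<close>

lemma binom_coeff_asymp:
  assumes "c \<ge> 0"
  shows "(\<lambda>n. binom_coeff (c + 1) n / real n powr c) \<longlonglongrightarrow> 1 / Gamma (c + 1)"
proof -
  have "(\<lambda>n. rGamma_series (c + 1) n * (real n / (real n + c + 1))) \<longlonglongrightarrow> rGamma (c + 1) * 1"
    by (intro tendsto_mult rGamma_series_LIMSEQ) real_asymp
  moreover have "eventually (\<lambda>n. rGamma_series (c + 1) n * (real n / (real n + c + 1)) =
      binom_coeff (c + 1) n / real n powr c) sequentially"
    using eventually_gt_at_top[of 0]
  proof eventually_elim
    case (elim n)
    have "exp ((c + 1) * ln (real n)) = real n powr c * real n"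
      using elim by (simp add: powr_def algebra_simps exp_add)
    then show ?case
      using elim assms
      by (simp add: rGamma_series_def binom_coeff_def pochhammer_Suc divide_simps)
  qed
  ultimately show ?thesis
    by (simp add: tendsto_cong rGamma_inverse_Gamma inverse_eq_divide)
qed

section \<open>The discrete Mittag-Leffler function\<close>

lemma summable_power_times_geometric:
  fixes \<alpha> q :: real
  assumes "\<alpha> > 0" "0 \<le> q" "q < 1"
  shows "summable (\<lambda>j. (1 + \<alpha> * real j) ^ n * q ^ j)"
proof -
  have "(\<lambda>j. (1 + \<alpha> * real (Suc j)) / (1 + \<alpha> * real j)) \<longlonglongrightarrow> 1"
    using assms(1) by real_asymp
  then have "(\<lambda>j. ((1 + \<alpha> * real (Suc j)) / (1 + \<alpha> * real j)) ^ n * q) \<longlonglongrightarrow> 1 ^ n * q"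
    by (intro tendsto_intros)
  \<comment> \<open>The ratios tend to \<open>q\<close>, and \<open>(1 + q) / 2\<close> lies
    strictly between \<open>q\<close> and 1.\<close>
  then have "eventually (\<lambda>j. ((1 + \<alpha> * real (Suc j)) / (1 + \<alpha> * real j)) ^ n * q < (1 + q) / 2) sequentially"
    using assms by (intro order_tendstoD) auto
  then obtain N where N: "\<And>j. j \<ge> N \<Longrightarrow>
      ((1 + \<alpha> * real (Suc j)) / (1 + \<alpha> * real j)) ^ n * q < (1 + q) / 2"
    unfolding eventually_sequentially by blast
  show ?thesis
  proof (rule summable_ratio_test)
    show "(1 + q) / 2 < 1" using assms by simp
    fix j assume "j \<ge> N"
    have p: "1 + \<alpha> * real j > 0" for j using assms by (simp add: add_pos_nonneg)
    have "(1 + \<alpha> * real (Suc j)) ^ n * q ^ Suc j =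
        (((1 + \<alpha> * real (Suc j)) / (1 + \<alpha> * real j)) ^ n * q) * ((1 + \<alpha> * real j) ^ n * q ^ j)"
      using p[of j] by (simp add: power_divide)
    also have "\<dots> \<le> (1 + q) / 2 * ((1 + \<alpha> * real j) ^ n * q ^ j)"
      using N[OF \<open>j \<ge> N\<close>] p[of j] assms by (intro mult_right_mono) auto
    finally show "norm ((1 + \<alpha> * real (Suc j)) ^ n * q ^ Suc j) \<le> (1 + q) / 2 * norm ((1 + \<alpha> * real j) ^ n * q ^ j)"
      using p[of j] p[of "Suc j"] assms by (simp add: abs_mult)
  qed
qed

text \<open>
  The coefficient of \<open>z ^ n\<close> in \<open>(1 - z) powr (\<alpha> - 1) / ((1 - z) powr \<alpha> + \<epsilon>)\<close>, expanded in powers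
  of \<open>\<epsilon>\<close>.
\<close>

definition discrete_ml :: "real \<Rightarrow> real \<Rightarrow> nat \<Rightarrow> real" where
  "discrete_ml \<alpha> \<epsilon> n = (\<Sum>j. (- \<epsilon>) ^ j * binom_coeff (\<alpha> * real j + 1) n)"

lemma summable_discrete_ml:
  assumes "0 < \<alpha>" "0 \<le> \<epsilon>" "\<epsilon> < 1"
  shows "summable (\<lambda>j. (- \<epsilon>) ^ j * binom_coeff (\<alpha> * real j + 1) n)"
proof (rule summable_comparison_test'[of _ 0])
  show "summable (\<lambda>j. (1 + \<alpha> * real j) ^ n * \<epsilon> ^ j)"
    using assms by (rule summable_power_times_geometric)
  show "norm ((- \<epsilon>) ^ j * binom_coeff (\<alpha> * real j + 1) n) \<le> (1 + \<alpha> * real j) ^ n * \<epsilon> ^ j" for j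
    using assms binom_coeff_nonneg[of "\<alpha> * real j + 1" n]
      mult_right_mono[OF binom_coeff_le_power[of "\<alpha> * real j" n], of "\<epsilon> ^ j"]
    by (simp add: abs_mult power_abs mult.commute)
qed

text \<open>
  Multiplication by \<open>(1 - z) powr \<alpha> + \<epsilon>\<close>, with the terms arranged so that all coefficients on the
  right are nonnegative; this is where \<open>\<alpha> < 1\<close> enters.
\<close>

lemma discrete_ml_rec:
  assumes "0 < \<alpha>" "0 \<le> \<epsilon>" "\<epsilon> < 1"
  shows "(1 + \<epsilon>) * discrete_ml \<alpha> \<epsilon> n =
    binom_coeff (1 - \<alpha>) n + (\<Sum>k=1..n. - binom_coeff (- \<alpha>) k * discrete_ml \<alpha> \<epsilon> (n - k))"
proof -
  note S = summable_discrete_ml[OF assms]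
  let ?t = "\<lambda>j n. (- \<epsilon>) ^ j * binom_coeff (\<alpha> * real j + 1) n"
  have "(\<Sum>k\<le>n. binom_coeff (- \<alpha>) k * discrete_ml \<alpha> \<epsilon> (n - k)) =
      (\<Sum>k\<le>n. \<Sum>j. binom_coeff (- \<alpha>) k * ?t j (n - k))"
    unfolding discrete_ml_def by (intro sum.cong refl suminf_mult[symmetric] S)
  also have "\<dots> = (\<Sum>j. \<Sum>k\<le>n. binom_coeff (- \<alpha>) k * ?t j (n - k))"
    by (intro suminf_sum[symmetric] summable_mult S)
  also have "\<dots> = (\<Sum>j. (- \<epsilon>) ^ j * binom_coeff (\<alpha> * (real j - 1) + 1) n)"
  proof (rule suminf_cong)
    fix j
    \<comment> \<open>Multiplying by \<open>(1 - z) powr \<alpha>\<close> lowers the exponent by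
      \<open>\<alpha>\<close>, which shifts \<open>j\<close> to \<open>j - 1\<close>.\<close>
    have "binom_coeff (\<alpha> * (real j - 1) + 1) n = binom_coeff (- \<alpha> + (\<alpha> * real j + 1)) n"
      by (simp add: algebra_simps)
    also have "\<dots> = (\<Sum>k\<le>n. binom_coeff (- \<alpha>) k * binom_coeff (\<alpha> * real j + 1) (n - k))"
      by (rule binom_coeff_add)
    finally show "(\<Sum>k\<le>n. binom_coeff (- \<alpha>) k * ?t j (n - k)) = (- \<epsilon>) ^ j * binom_coeff (\<alpha> * (real j - 1) + 1) n"
      by (simp add: sum_distrib_left mult_ac)
  qed
  also have "\<dots> = binom_coeff (1 - \<alpha>) n - \<epsilon> * discrete_ml \<alpha> \<epsilon> n"
  proof -
    \<comment> \<open>The term \<open>j = 0\<close> gives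
      \<open>binom_coeff (1 - \<alpha>) n\<close>; the others reproduce the original series with one
      factor \<open>- \<epsilon>\<close> split off.\<close>
    let ?u = "\<lambda>j. (- \<epsilon>) ^ j * binom_coeff (\<alpha> * (real j - 1) + 1) n"
    have u: "?u (Suc j) = (- \<epsilon>) * ?t j n" for j by simp
    have "summable (\<lambda>j. ?u (Suc j))"
      unfolding u by (intro summable_mult S)
    then have "summable ?u" by (subst (asm) summable_Suc_iff)
    from suminf_split_head[OF this] have "(\<Sum>j. ?u j) = (\<Sum>j. ?u (Suc j)) + ?u 0" by simp
    also have "(\<Sum>j. ?u (Suc j)) = (- \<epsilon>) * discrete_ml \<alpha> \<epsilon> n"
      unfolding u discrete_ml_def by (intro suminf_mult S)
    finally show ?thesis by simp
  qed
  finally have "(\<Sum>k\<le>n. binom_coeff (- \<alpha>) k * discrete_ml \<alpha> \<epsilon> (n - k)) =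
    binom_coeff (1 - \<alpha>) n - \<epsilon> * discrete_ml \<alpha> \<epsilon> n" .
  \<comment> \<open>The term \<open>k = 0\<close> joins the \<open>\<epsilon>\<close> term on the
    left and yields the factor \<open>1 + \<epsilon>\<close>.\<close>
  moreover have "{..n} = insert 0 {1..n}" by auto
  ultimately show ?thesis
    by (simp add: sum_negf algebra_simps)
qed

text \<open>Strong induction: the recurrence expresses the value through earlier ones with
  nonnegative weights and a nonnegative inhomogeneity.\<close>

lemma discrete_ml_nonneg:
  assumes "0 < \<alpha>" "\<alpha> < 1" "0 \<le> \<epsilon>" "\<epsilon> < 1"
  shows "discrete_ml \<alpha> \<epsilon> n \<ge> 0"
proof (induction n rule: less_induct)
  case (less n)
  have "(\<Sum>k=1..n. - binom_coeff (- \<alpha>) k * discrete_ml \<alpha> \<epsilon> (n - k)) \<ge> 0"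
    using less binom_coeff_neg[OF assms(1,2)] by (intro sum_nonneg mult_nonneg_nonneg) auto
  moreover have "binom_coeff (1 - \<alpha>) n \<ge> 0"
    using assms by (intro binom_coeff_nonneg) auto
  ultimately have "(1 + \<epsilon>) * discrete_ml \<alpha> \<epsilon> n \<ge> 0"
    using discrete_ml_rec[of \<alpha> \<epsilon> n] assms by simp
  then show ?case
    using assms by (simp add: zero_le_mult_iff)
qed

text \<open>Apart from the earlier values, the right side of the recurrence is independent of
  \<open>\<epsilon>\<close>. Increasing \<open>\<epsilon>\<close> thus lowers the right side by
  induction and enlarges the factor \<open>1 + \<epsilon>\<close> on the left.\<close>

lemma discrete_ml_antimono:
  assumes "0 < \<alpha>" "\<alpha> < 1" "0 \<le> \<epsilon>" "\<epsilon> \<le> \<delta>" "\<delta> < 1"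
  shows "discrete_ml \<alpha> \<delta> n \<le> discrete_ml \<alpha> \<epsilon> n"
proof (induction n rule: less_induct)
  case (less n)
  have "(\<Sum>k=1..n. - binom_coeff (- \<alpha>) k * discrete_ml \<alpha> \<delta> (n - k)) \<le>
      (\<Sum>k=1..n. - binom_coeff (- \<alpha>) k * discrete_ml \<alpha> \<epsilon> (n - k))"
    using less binom_coeff_neg[OF assms(1,2)] by (intro sum_mono mult_left_mono) auto
  then have "(1 + \<delta>) * discrete_ml \<alpha> \<delta> n \<le> (1 + \<epsilon>) * discrete_ml \<alpha> \<epsilon> n"
    using discrete_ml_rec[of \<alpha> \<epsilon> n] discrete_ml_rec[of \<alpha> \<delta> n] assms by simp
  also have "\<dots> \<le> (1 + \<delta>) * discrete_ml \<alpha> \<epsilon> n"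
    using assms discrete_ml_nonneg[of \<alpha> \<epsilon> n] by (intro mult_right_mono) auto
  finally show ?case
    using assms by simp
qed

section \<open>Passage to the Mittag-Leffler function\<close>

text \<open>Termwise convergence is \<open>binom_coeff_asymp\<close>; Tannery's theorem, the
  discrete form of dominated convergence, exchanges limit and sum.\<close>

lemma discrete_ml_limit:
  assumes "0 < \<alpha>" "x \<ge> 0"
  shows "(\<lambda>n. discrete_ml \<alpha> (x / real n powr \<alpha>) n) \<longlonglongrightarrow> mittag_leffler \<alpha> (- x)"
proof -
  \<comment> \<open>A fixed \<open>k\<close> with \<open>x / k powr \<alpha> < 1\<close> makes
    \<open>binom_coeff_le\<close> a majorant for all \<open>n \<ge> k\<close> that is polynomial in
    \<open>j\<close> times \<open>q ^ j\<close> with \<open>q < 1\<close>.\<close>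
  have "filterlim (\<lambda>k. real k powr \<alpha>) at_top sequentially"
    using assms by real_asymp
  then have "eventually (\<lambda>k. real k powr \<alpha> > x) sequentially"
    by (simp add: filterlim_at_top_dense)
  then obtain k where k: "k \<ge> 1" "real k powr \<alpha> > x"
    using eventually_conj[OF _ eventually_ge_at_top[of 1]] eventually_happens'[OF sequentially_bot]
    by (metis (mono_tags, lifting))
  define q where "q = x / real k powr \<alpha>"
  have q: "0 \<le> q" "q < 1" using k assms by (auto simp: q_def)
  have term_eq: "(- (x / real n powr \<alpha>)) ^ j * binom_coeff (\<alpha> * real j + 1) n =
      (- x) ^ j * (binom_coeff (\<alpha> * real j + 1) n / real n powr (\<alpha> * real j))" if "n \<ge> 1" for n j
    using that by (simp add: power_divide powr_powr[symmetric] powr_realpow minus_divide_left del: divide_minus_left)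
  have "((\<lambda>n. \<Sum>j. (- (x / real n powr \<alpha>)) ^ j * binom_coeff (\<alpha> * real j + 1) n)
      \<longlongrightarrow> (\<Sum>j. (- x) ^ j / Gamma (\<alpha> * real j + 1))) sequentially"
  proof (rule tannerys_theorem[THEN conjunct2, THEN conjunct2])
    fix j
    have "(\<lambda>n. (- x) ^ j * (binom_coeff (\<alpha> * real j + 1) n / real n powr (\<alpha> * real j)))
        \<longlonglongrightarrow> (- x) ^ j * (1 / Gamma (\<alpha> * real j + 1))"
      using assms by (intro tendsto_mult tendsto_const binom_coeff_asymp) auto
    moreover have "eventually (\<lambda>n. (- (x / real n powr \<alpha>)) ^ j * binom_coeff (\<alpha> * real j + 1) n =
        (- x) ^ j * (binom_coeff (\<alpha> * real j + 1) n / real n powr (\<alpha> * real j))) sequentially"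
      using eventually_ge_at_top[of 1] by (rule eventually_mono) (rule term_eq)
    ultimately show "(\<lambda>n. (- (x / real n powr \<alpha>)) ^ j * binom_coeff (\<alpha> * real j + 1) n)
        \<longlonglongrightarrow> (- x) ^ j / Gamma (\<alpha> * real j + 1)"
      by (simp add: tendsto_cong)
  next
    have "norm ((- (x / real n powr \<alpha>)) ^ j * binom_coeff (\<alpha> * real j + 1) n) \<le>
        (1 + \<alpha> * real j) ^ k * q ^ j" if "n \<ge> k" for n j
    proof -
      have n: "n \<ge> 1" using k that by simp
      have "binom_coeff (\<alpha> * real j + 1) n \<le>
          (1 + \<alpha> * real j) ^ k * (real n powr (\<alpha> * real j) / real k powr (\<alpha> * real j))"
        using k that assms by (intro binom_coeff_le) auto
      then have "binom_coeff (\<alpha> * real j + 1) n / real n powr (\<alpha> * real j) \<le>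
          (1 + \<alpha> * real j) ^ k * (1 / real k powr (\<alpha> * real j))"
        using n by (simp add: field_simps)
      then have "x ^ j * (binom_coeff (\<alpha> * real j + 1) n / real n powr (\<alpha> * real j)) \<le>
          x ^ j * ((1 + \<alpha> * real j) ^ k * (1 / real k powr (\<alpha> * real j)))"
        using assms by (intro mult_left_mono) auto
      also have "\<dots> = (1 + \<alpha> * real j) ^ k * q ^ j"
        using k by (simp add: q_def power_divide powr_powr[symmetric] powr_realpow)
      finally show ?thesis
        using assms n binom_coeff_nonneg[of "\<alpha> * real j + 1" n]
        by (simp add: term_eq abs_mult power_abs)
    qed
    then show "eventually (\<lambda>(j, n). norm ((- (x / real n powr \<alpha>)) ^ j * binom_coeff (\<alpha> * real j + 1) n)
        \<le> (1 + \<alpha> * real j) ^ k * q ^ j) (sequentially \<times>\<^sub>F sequentially)"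
      by (auto simp: eventually_prod_sequentially)
    show "summable (\<lambda>j. (1 + \<alpha> * real j) ^ k * q ^ j)"
      using assms q by (intro summable_power_times_geometric)
  qed auto
  then show ?thesis
    by (simp add: discrete_ml_def mittag_leffler_def)
qed

text \<open>The discrete sign and monotonicity results require \<open>\<epsilon> < 1\<close>;
  holding eventually is enough to pass to the limit.\<close>

lemma eventually_divide_powr_lt_one:
  fixes \<alpha> x :: real
  assumes "\<alpha> > 0"
  shows "eventually (\<lambda>n. x / real n powr \<alpha> < 1) sequentially"
proof -
  have "(\<lambda>n. x / real n powr \<alpha>) \<longlonglongrightarrow> 0" using assms by real_asymp
  then show ?thesis by (rule order_tendstoD) simp
qed

lemma mittag_leffler_nonneg:
  assumes "0 < \<alpha>" "\<alpha> < 1" "x \<ge> 0"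
  shows "mittag_leffler \<alpha> (- x) \<ge> 0"
proof (rule tendsto_lowerbound[OF discrete_ml_limit])
  show "eventually (\<lambda>n. 0 \<le> discrete_ml \<alpha> (x / real n powr \<alpha>) n) sequentially"
    using eventually_divide_powr_lt_one[OF assms(1), of x]
    by eventually_elim (use assms in \<open>auto intro!: discrete_ml_nonneg\<close>)
qed (use assms in auto)

lemma mittag_leffler_antimono:
  assumes "0 < \<alpha>" "\<alpha> < 1" "0 \<le> x" "x \<le> y"
  shows "mittag_leffler \<alpha> (- y) \<le> mittag_leffler \<alpha> (- x)"
proof (rule tendsto_le[OF _ discrete_ml_limit discrete_ml_limit])
  show "eventually (\<lambda>n. discrete_ml \<alpha> (y / real n powr \<alpha>) n \<le> discrete_ml \<alpha> (x / real n powr \<alpha>) n) sequentially"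
    using eventually_divide_powr_lt_one[OF assms(1), of y]
    by eventually_elim (use assms in \<open>auto intro!: discrete_ml_antimono divide_right_mono\<close>)
qed (use assms in auto)

lemma mittag_leffler_0: "mittag_leffler \<alpha> 0 = 1"
proof -
  have "(\<Sum>k. 0 ^ k / Gamma (\<alpha> * real k + 1)) = (\<Sum>k\<in>{0}. (0::real) ^ k / Gamma (\<alpha> * real k + 1))"
    by (rule suminf_finite) auto
  then show ?thesis by (simp add: mittag_leffler_def)
qed

section \<open>Smooth cutoff functions and weak derivatives\<close>

text \<open>A syntactic class closed under differentiation, so that smoothness of cutoffs follows by
  induction on the order. The polynomial in \<open>1 / x\<close> absorbs the factors produced by
  differentiating \<open>exp (- (1 / x))\<close>.\<close>

inductive_set smooth_class :: "(real \<Rightarrow> real) set" where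
  flat: "(\<lambda>x. if x \<le> 0 then 0 else poly p (1 / x) * exp (- (1 / x))) \<in> smooth_class"
| affine: "\<phi> \<in> smooth_class \<Longrightarrow> (\<lambda>x. \<phi> (c * x + d)) \<in> smooth_class"
| scale: "\<phi> \<in> smooth_class \<Longrightarrow> (\<lambda>x. c * \<phi> x) \<in> smooth_class"
| add: "\<phi> \<in> smooth_class \<Longrightarrow> \<psi> \<in> smooth_class \<Longrightarrow> (\<lambda>x. \<phi> x + \<psi> x) \<in> smooth_class"
| mult: "\<phi> \<in> smooth_class \<Longrightarrow> \<psi> \<in> smooth_class \<Longrightarrow> (\<lambda>x. \<phi> x * \<psi> x) \<in> smooth_class"
| inverse: "\<phi> \<in> smooth_class \<Longrightarrow> (\<And>x. \<phi> x \<noteq> 0) \<Longrightarrow> (\<lambda>x. inverse (\<phi> x)) \<in> smooth_class"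

lemma poly_times_exp_minus_tendsto_0: "((\<lambda>y::real. poly p y * exp (- y)) \<longlongrightarrow> 0) at_top"
proof -
  have "((\<lambda>y::real. \<Sum>i\<le>degree p. coeff p i * (y ^ i / exp y)) \<longlongrightarrow> (\<Sum>i\<le>degree p. coeff p i * 0)) at_top"
    by (intro tendsto_intros tendsto_power_div_exp_0)
  then show ?thesis
    by (simp add: poly_altdef sum_distrib_right exp_minus divide_inverse mult.assoc)
qed

text \<open>With \<open>y = 1 / x\<close> one has \<open>d/dx = - y^2 d/dy\<close>, which turns
  \<open>p(y) exp (- y)\<close> into \<open>y^2 (p - p')(y) exp (- y)\<close>. At 0 exponential
  decay beats every polynomial.\<close>

lemma flat_has_real_derivative:
  fixes p :: "real poly"
  defines "F \<equiv> \<lambda>p x. if x \<le> 0 then 0 else poly p (1 / x) * exp (- (1 / x))"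
  shows "(F p has_real_derivative F (monom 1 2 * (p - pderiv p)) x) (at x)"
proof -
  consider "x < 0" | "x = 0" | "x > 0" by linarith
  then show ?thesis
  proof cases
    case 1
    have "(F p has_real_derivative 0) (at x)"
      by (rule has_field_derivative_transform_within_open[where f = "\<lambda>_. 0" and S = "{..<0}"])
         (use 1 in \<open>auto simp: F_def\<close>)
    then show ?thesis using 1 by (simp add: F_def)
  next
    case 2
    \<comment> \<open>The factor \<open>monom 1 1\<close> is the \<open>1 / h\<close> of the
      difference quotient at 0.\<close>
    have "((\<lambda>y. poly (monom 1 1 * p) (inverse y) * exp (- inverse y)) \<longlongrightarrow> 0) (at_right (0::real))"
      by (rule filterlim_compose[OF poly_times_exp_minus_tendsto_0 filterlim_inverse_at_top_right])
    then have "((\<lambda>h. F p h / h) \<longlongrightarrow> 0) (at_right 0)"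
      by (rule tendsto_cong[THEN iffD1, rotated])
         (auto simp: F_def eventually_at_right_field poly_monom field_simps intro!: exI[of _ 1])
    moreover have "((\<lambda>h. F p h / h) \<longlongrightarrow> 0) (at_left 0)"
      by (rule tendsto_eventually) (auto simp: F_def eventually_at_left_field intro!: exI[of _ "-1"])
    ultimately have "((\<lambda>h. F p h / h) \<longlongrightarrow> 0) (at 0)"
      by (simp add: filterlim_split_at)
    then show ?thesis using 2 by (simp add: DERIV_def) (simp add: F_def)
  next
    case 3
    have inv: "((\<lambda>x. 1 / x) has_real_derivative - (1 / x\<^sup>2)) (at x)"
      using 3 by (auto intro!: derivative_eq_intros simp: power2_eq_square)
    have "((\<lambda>x. poly p (1 / x) * exp (- (1 / x))) has_real_derivative
        poly (pderiv p) (1 / x) * (- (1 / x\<^sup>2)) * exp (- (1 / x)) + exp (- (1 / x)) * (1 / x\<^sup>2) * poly p (1 / x)) (at x)"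
      using DERIV_mult[OF DERIV_chain'[OF inv poly_DERIV] DERIV_fun_exp[OF DERIV_minus[OF inv]]] by simp
    also have "poly (pderiv p) (1 / x) * (- (1 / x\<^sup>2)) * exp (- (1 / x)) + exp (- (1 / x)) * (1 / x\<^sup>2) * poly p (1 / x)
        = F (monom 1 2 * (p - pderiv p)) x"
      using 3 by (simp add: F_def poly_monom field_simps)
    finally show ?thesis
      by (rule has_field_derivative_transform_within_open[where S = "{0<..}"])
         (use 3 in \<open>auto simp: F_def\<close>)
  qed
qed

lemma smooth_class_deriv:
  assumes "\<phi> \<in> smooth_class"
  shows "\<exists>\<psi>\<in>smooth_class. \<forall>x. (\<phi> has_real_derivative \<psi> x) (at x)"
  using assms
proof induction
  case (flat p)
  show ?case
    by (intro bexI[OF _ smooth_class.flat[of "monom 1 2 * (p - pderiv p)"]] allI flat_has_real_derivative)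
next
  case (affine \<phi> c d)
  then obtain \<psi> where "\<psi> \<in> smooth_class" and D: "\<And>x. (\<phi> has_real_derivative \<psi> x) (at x)" by blast
  have "((\<lambda>x. \<phi> (c * x + d)) has_real_derivative c * \<psi> (c * x + d)) (at x)" for x
    by (rule DERIV_cong[OF DERIV_chain'[where g = \<phi>, OF _ D]]) (auto intro!: derivative_eq_intros)
  then show ?case
    using smooth_class.scale[OF smooth_class.affine[OF \<open>\<psi> \<in> smooth_class\<close>, of c d], of c]
    by (intro bexI[of _ "\<lambda>x. c * \<psi> (c * x + d)"]) auto
next
  case (scale \<phi> c)
  then obtain \<psi> where "\<psi> \<in> smooth_class" "\<And>x. (\<phi> has_real_derivative \<psi> x) (at x)" by blast
  then show ?case
    by (intro bexI[of _ "\<lambda>x. c * \<psi> x"]) (auto intro!: smooth_class.scale DERIV_cmult)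
next
  case (add \<phi>1 \<phi>2)
  then obtain \<psi>1 \<psi>2 where "\<psi>1 \<in> smooth_class" "\<And>x. (\<phi>1 has_real_derivative \<psi>1 x) (at x)"
    "\<psi>2 \<in> smooth_class" "\<And>x. (\<phi>2 has_real_derivative \<psi>2 x) (at x)" by blast
  then show ?case
    by (intro bexI[of _ "\<lambda>x. \<psi>1 x + \<psi>2 x"]) (auto intro!: smooth_class.add DERIV_add)
next
  case (mult \<phi>1 \<phi>2)
  then obtain \<psi>1 \<psi>2 where "\<psi>1 \<in> smooth_class" "\<And>x. (\<phi>1 has_real_derivative \<psi>1 x) (at x)"
    "\<psi>2 \<in> smooth_class" "\<And>x. (\<phi>2 has_real_derivative \<psi>2 x) (at x)" by blast
  with mult show ?case
    by (intro bexI[of _ "\<lambda>x. \<psi>1 x * \<phi>2 x + \<psi>2 x * \<phi>1 x"])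
       (auto intro!: smooth_class.add smooth_class.mult DERIV_mult)
next
  case (inverse \<phi>)
  then obtain \<psi> where "\<psi> \<in> smooth_class" "\<And>x. (\<phi> has_real_derivative \<psi> x) (at x)" by blast
  with inverse show ?case
    by (intro bexI[OF _ smooth_class.scale[of "\<lambda>x. inverse (\<phi> x) * \<psi> x * inverse (\<phi> x)" "- 1"]])
       (auto intro!: smooth_class.mult smooth_class.inverse derivative_eq_intros)
qed

text \<open>The derivative in direction \<open>v\<close> is \<open>v\<close> times a member of the
  class, so the induction over \<open>k\<close> stays inside it.\<close>

lemma smooth_class_smooth_on:
  assumes "\<phi> \<in> smooth_class"
  shows "smooth_on UNIV \<phi>"
  unfolding smooth_on_def
proof
  fix k
  show "Ck_on k UNIV \<phi>"
    using assms
  proof (induction k arbitrary: \<phi>)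
    case 0
    then show ?case
      using smooth_class_deriv[of \<phi>] by (auto intro!: continuous_at_imp_continuous_on DERIV_isCont)
  next
    case (Suc k)
    obtain \<psi> where \<psi>: "\<psi> \<in> smooth_class" "\<And>x. (\<phi> has_real_derivative \<psi> x) (at x)"
      using smooth_class_deriv[OF Suc.prems] by blast
    have "Ck_on k UNIV (\<lambda>x. \<psi> x * v)" for v
      using Suc.IH[OF smooth_class.scale[OF \<psi>(1), of v]] by (simp add: mult.commute)
    then show ?case
      using \<psi>(2) unfolding Ck_on.simps has_field_derivative_def
      by (intro exI[of _ "\<lambda>x. times (\<psi> x)"]) simp
  qed
qed

lemma smooth_step_exists:
  obtains \<Phi> \<rho> :: "real \<Rightarrow> real" where
    "\<Phi> \<in> smooth_class" "\<And>x. (\<Phi> has_real_derivative \<rho> x) (at x)" "continuous_on UNIV \<rho>"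
    "\<And>x. 0 \<le> \<Phi> x" "\<And>x. \<Phi> x \<le> 1" "\<And>x. x \<le> 0 \<Longrightarrow> \<Phi> x = 0" "\<And>x. x \<ge> 1 \<Longrightarrow> \<Phi> x = 1"
proof -
  define F :: "real \<Rightarrow> real" where "F = (\<lambda>x. if x \<le> 0 then 0 else poly 1 (1 / x) * exp (- (1 / x)))"
  have F: "F \<in> smooth_class" unfolding F_def by (rule smooth_class.flat)
  have F1: "(\<lambda>x. F (1 - x)) \<in> smooth_class"
    using smooth_class.affine[OF F, of "-1" 1] by simp
  have F_pos: "F x \<ge> 0" "x > 0 \<Longrightarrow> F x > 0" "x \<le> 0 \<Longrightarrow> F x = 0" for x by (auto simp: F_def)
  \<comment> \<open>\<open>x\<close> and \<open>1 - x\<close> cannot both be nonpositive, so the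
    quotient \<open>F x / (F x + F (1 - x))\<close> is defined everywhere.\<close>
  have pos: "F x + F (1 - x) > 0" for x
    using F_pos(1,2)[of x] F_pos(1,2)[of "1 - x"] by (cases "x > 0") (auto intro: add_pos_nonneg add_nonneg_pos)
  define \<Phi> where "\<Phi> = (\<lambda>x. F x * inverse (F x + F (1 - x)))"
  have "\<Phi> \<in> smooth_class"
    unfolding \<Phi>_def using pos
    by (intro smooth_class.mult smooth_class.inverse smooth_class.add F F1) (metis less_irrefl)
  moreover obtain \<rho> where \<rho>: "\<rho> \<in> smooth_class" "\<And>x. (\<Phi> has_real_derivative \<rho> x) (at x)"
    using smooth_class_deriv[OF calculation] by blast
  moreover have "continuous_on UNIV \<rho>"
    using smooth_class_deriv[OF \<rho>(1)] by (auto intro!: continuous_at_imp_continuous_on DERIV_isCont)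
  moreover have "0 \<le> \<Phi> x" "\<Phi> x \<le> 1" for x
    using pos[of x] F_pos(1)[of x] F_pos(1)[of "1 - x"] by (simp_all add: \<Phi>_def field_simps)
  moreover have "\<Phi> x = 0" if "x \<le> 0" for x
    using that by (simp add: \<Phi>_def F_pos)
  moreover have "\<Phi> x = 1" if "x \<ge> 1" for x
    using that pos[of x] F_pos(3)[of "1 - x"] by (simp add: \<Phi>_def)
  ultimately show thesis using that by blast
qed

section \<open>Fundamental theorem of calculus for weak derivatives\<close>

text \<open>The kernels form an approximate identity: support in \<open>[s, s + 1/n]\<close>, and
  mass 1 because \<open>\<Phi>\<close> climbs from 0 to 1. A sign of \<open>\<rho>\<close> is
  replaced by the bound \<open>M\<close>, since height \<open>n * M\<close> times width
  \<open>1 / n\<close> stays bounded.\<close>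

lemma step_kernel_tendsto:
  fixes w \<Phi> \<rho> :: "real \<Rightarrow> real"
  assumes w: "continuous_on {a..b} w" and s: "a < s" "s < b"
    and \<Phi>: "\<And>x. (\<Phi> has_real_derivative \<rho> x) (at x)" "continuous_on UNIV \<rho>"
      "\<And>x. x \<le> 0 \<Longrightarrow> \<Phi> x = 0" "\<And>x. x \<ge> 1 \<Longrightarrow> \<Phi> x = 1"
  shows "(\<lambda>n. integral {a..b} (\<lambda>x. w x * (real n * \<rho> (real n * (x - s))))) \<longlonglongrightarrow> w s"
proof -
  have \<rho>0: "\<rho> x = 0" if "x < 0 \<or> x > 1" for x
  proof -
    have "(\<Phi> has_real_derivative 0) (at x)"
    proof (cases "x < 0")
      case True
      show ?thesis
        by (rule has_field_derivative_transform_within_open[where f = "\<lambda>_. 0" and S = "{..<0}"])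
           (use True in \<open>auto simp: \<Phi>(3)\<close>)
    next
      case False
      show ?thesis
        by (rule has_field_derivative_transform_within_open[where f = "\<lambda>_. 1" and S = "{1<..}"])
           (use False that in \<open>auto simp: \<Phi>(4)\<close>)
    qed
    then show ?thesis using \<Phi>(1) DERIV_unique by blast
  qed
  have "compact (\<rho> ` {0..1})"
    using \<Phi>(2) by (intro compact_continuous_image) (auto intro: continuous_on_subset)
  then obtain M where "M > 0" "\<forall>y\<in>\<rho> ` {0..1}. norm y \<le> M"
    using compact_imp_bounded[of "\<rho> ` {0..1}"] unfolding bounded_pos by blast
  then have M: "\<And>x. x \<in> {0..1} \<Longrightarrow> \<bar>\<rho> x\<bar> \<le> M" "M > 0" by auto
  define k where "k n x = real n * \<rho> (real n * (x - s))" for n x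
  have k_cont [continuous_intros]: "continuous_on X (k n)" for n X
    unfolding k_def
    by (intro continuous_intros continuous_on_compose2[OF \<Phi>(2)]) auto
  have "((\<lambda>n. integral {a..b} (\<lambda>x. w x * k n x)) \<longlongrightarrow> w s) sequentially"
  proof (rule tendstoI)
    fix e :: real assume "e > 0"
    have "isCont w s" using w s by (intro continuous_on_interior[OF w]) (auto simp: interior_atLeastAtMost_real)
    then obtain d where d: "d > 0" "\<And>x. dist x s < d \<Longrightarrow> dist (w x) (w s) < e / (2 * M)"
      unfolding continuous_at_eps_delta dist_real_def
      using \<open>e > 0\<close> M by (metis divide_pos_pos mult_pos_pos zero_less_numeral)
    \<comment> \<open>Below \<open>d\<close> the support lies where \<open>w\<close> is close to
      \<open>w s\<close>; below \<open>b - s\<close> it lies inside \<open>{a..b}\<close>, so no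
      mass is lost.\<close>
    have "eventually (\<lambda>n. inverse (real n) < min d (b - s)) sequentially"
      using d s by (intro order_tendstoD(2)[OF lim_inverse_n]) auto
    then show "eventually (\<lambda>n. dist (integral {a..b} (\<lambda>x. w x * k n x)) (w s) < e) sequentially"
      using eventually_gt_at_top[of 0]
    proof eventually_elim
      case (elim n)
      define r where "r = inverse (real n)"
      have r: "r > 0" "r < d" "s + r < b" "real n * r = 1" using elim by (auto simp: r_def)
      have sub: "{s..s + r} \<subseteq> {a..b}" using s r by auto
      have k_zero: "k n x = 0" if "x \<notin> {s..s + r}" for x
      proof -
        from that consider "x < s" | "x > s + r" by fastforce
        then have "real n * (x - s) < 0 \<or> real n * (x - s) > 1"
        proof cases
          case 1 then show ?thesis using elim by (simp add: mult_pos_neg)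
        next
          case 2
          then have "real n * r < real n * (x - s)" using elim by (intro mult_strict_left_mono) auto
          then show ?thesis using r by simp
        qed
        then show ?thesis by (simp add: k_def \<rho>0)
      qed
      have "((\<lambda>x. k n x) has_integral \<Phi> (real n * (b - s)) - \<Phi> (real n * (a - s))) {a..b}"
      proof (rule fundamental_theorem_of_calculus)
        fix x
        have "((\<lambda>x. \<Phi> (real n * (x - s))) has_real_derivative k n x) (at x)"
          unfolding k_def
          by (rule DERIV_cong[OF DERIV_chain'[OF _ \<Phi>(1)]]) (auto intro!: derivative_eq_intros)
        then show "((\<lambda>x. \<Phi> (real n * (x - s))) has_vector_derivative k n x) (at x within {a..b})"
          by (simp add: has_real_derivative_iff_has_vector_derivative has_vector_derivative_at_within)
      qed (use s in auto)
      moreover have "\<Phi> (real n * (b - s)) = 1"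
      proof (rule \<Phi>(4))
        have "real n * r \<le> real n * (b - s)" using r by (intro mult_left_mono) auto
        then show "1 \<le> real n * (b - s)" using r by simp
      qed
      moreover have "\<Phi> (real n * (a - s)) = 0"
        using s by (intro \<Phi>(3)) (simp add: mult_nonneg_nonpos)
      ultimately have k1: "integral {a..b} (k n) = 1" by (simp add: integral_unique)
      have "integral {a..b} (\<lambda>x. w x * k n x) - w s =
          integral {a..b} (\<lambda>x. w x * k n x) - integral {a..b} (\<lambda>x. w s * k n x)"
        by (simp add: k1)
      also have "\<dots> = integral {a..b} (\<lambda>x. w x * k n x - w s * k n x)"
        by (rule integral_diff[symmetric])
           (auto intro!: integrable_continuous_real continuous_intros w)
      also have "\<dots> = integral {s..s + r} (\<lambda>x. w x * k n x - w s * k n x)"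
      proof (rule integral_spike_set)
        have "{x \<in> {a..b} - {s..s + r}. w x * k n x - w s * k n x \<noteq> 0} = {}" using k_zero by auto
        then show "negligible {x \<in> {a..b} - {s..s + r}. w x * k n x - w s * k n x \<noteq> 0}" by (simp only: negligible_empty)
        have "{x \<in> {s..s + r} - {a..b}. w x * k n x - w s * k n x \<noteq> 0} = {}" using sub by blast
        then show "negligible {x \<in> {s..s + r} - {a..b}. w x * k n x - w s * k n x \<noteq> 0}" by (simp only: negligible_empty)
      qed
      finally have eq: "integral {a..b} (\<lambda>x. w x * k n x) - w s = \<dots>" .
      have "norm (integral {s..s + r} (\<lambda>x. w x * k n x - w s * k n x)) \<le>
          (e / (2 * M) * (real n * M)) * (s + r - s)"
      proof (rule integral_bound)
        show "continuous_on {s..s + r} (\<lambda>x. w x * k n x - w s * k n x)"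
          using w sub by (intro continuous_intros) (auto intro: continuous_on_subset)
        fix x assume x: "x \<in> {s..s + r}"
        have "real n * (x - s) \<le> real n * r" using x by (intro mult_left_mono) auto
        then have "\<bar>\<rho> (real n * (x - s))\<bar> \<le> M" using x r by (intro M) auto
        then have "\<bar>k n x\<bar> \<le> real n * M" by (simp add: k_def abs_mult mult_left_mono)
        moreover have "\<bar>w x - w s\<bar> \<le> e / (2 * M)"
          using d(2)[of x] x r by (auto simp: dist_real_def)
        ultimately have "\<bar>w x - w s\<bar> * \<bar>k n x\<bar> \<le> e / (2 * M) * (real n * M)"
          using M \<open>e > 0\<close> by (intro mult_mono) auto
        then show "norm (w x * k n x - w s * k n x) \<le> e / (2 * M) * (real n * M)"
          by (simp add: abs_mult flip: left_diff_distrib)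
      qed (use r in auto)
      also have "\<dots> = e / 2" using M r by (simp add: field_simps)
      also have "\<dots> < e" using \<open>e > 0\<close> by simp
      finally show ?case using eq by (simp add: dist_real_def)
    qed
  qed
  then show ?thesis by (simp add: k_def)
qed

text \<open>Tests the weak derivative against smooth approximations of the indicator of \<open>{s<..t}\<close>.\<close>

lemma weak_deriv_ftc_interior:
  assumes w: "continuous_on {a..b} w" and g: "set_integrable lborel {a<..<b} g"
    and weak: "has_weak_deriv a b w g" and st: "a < s" "s \<le> t" "t < b"
  shows "integral {s..t} g = w t - w s"
proof -
  obtain \<Phi> \<rho> :: "real \<Rightarrow> real" where
    \<Phi>: "\<Phi> \<in> smooth_class" "\<And>x. (\<Phi> has_real_derivative \<rho> x) (at x)" "continuous_on UNIV \<rho>"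
      "\<And>x. 0 \<le> \<Phi> x" "\<And>x. \<Phi> x \<le> 1" "\<And>x. x \<le> 0 \<Longrightarrow> \<Phi> x = 0" "\<And>x. x \<ge> 1 \<Longrightarrow> \<Phi> x = 1"
    using smooth_step_exists by blast
  \<comment> \<open>A plateau rising on \<open>[s, s + 1/n]\<close> and falling on
    \<open>[t, t + 1/n]\<close>.\<close>
  define \<phi> where "\<phi> n x = \<Phi> (real n * (x - s)) - \<Phi> (real n * (x - t))" for n x
  define \<phi>' where "\<phi>' n x = real n * \<rho> (real n * (x - s)) - real n * \<rho> (real n * (x - t))" for n x
  have D: "(\<phi> n has_real_derivative \<phi>' n x) (at x)" for n x
  proof -
    have "((\<lambda>x. \<Phi> (real n * (x - r))) has_real_derivative real n * \<rho> (real n * (x - r))) (at x)" for r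
      by (rule DERIV_cong[OF DERIV_chain'[OF _ \<Phi>(2)]]) (auto intro!: derivative_eq_intros)
    then show ?thesis unfolding \<phi>_def \<phi>'_def by (intro DERIV_diff)
  qed
  have \<phi>_smooth: "\<phi> n \<in> smooth_class" for n
  proof -
    have "(\<lambda>x. \<Phi> (real n * x + - (real n * s)) + (- 1) * \<Phi> (real n * x + - (real n * t))) \<in> smooth_class"
      by (intro smooth_class.add smooth_class.affine smooth_class.scale \<Phi>(1))
    then show ?thesis by (simp add: \<phi>_def[abs_def] algebra_simps)
  qed
  have \<phi>_meas [measurable]: "\<phi> n \<in> borel_measurable borel" for n
    using D by (intro borel_measurable_continuous_onI) (auto intro!: continuous_at_imp_continuous_on DERIV_isCont)
  have lim1: "(\<lambda>n. LINT x:{a<..<b}|lborel. w x * deriv (\<phi> n) x) \<longlonglongrightarrow> w s - w t"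
  proof -
    have cont: "continuous_on {a..b} (\<lambda>x. w x * (real n * \<rho> (real n * (x - r))))" for n r
      by (intro continuous_intros w continuous_on_compose2[OF \<Phi>(3)]) auto
    have "(LINT x:{a<..<b}|lborel. w x * deriv (\<phi> n) x) =
        integral {a..b} (\<lambda>x. w x * (real n * \<rho> (real n * (x - s)))) -
        integral {a..b} (\<lambda>x. w x * (real n * \<rho> (real n * (x - t))))" for n
    proof -
      have c: "continuous_on {a..b} (\<lambda>x. w x * \<phi>' n x)"
        using continuous_on_diff[OF cont cont] by (simp add: \<phi>'_def right_diff_distrib)
      have "(LINT x:{a<..<b}|lborel. w x * deriv (\<phi> n) x) = (LINT x:{a<..<b}|lborel. w x * \<phi>' n x)"
        using DERIV_imp_deriv[OF D] by simp
      also have "\<dots> = integral {a<..<b} (\<lambda>x. w x * \<phi>' n x)"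
        by (intro set_borel_integral_eq_integral set_integrable_subset[OF borel_integrable_atLeastAtMost'[OF c]]) auto
      also have "\<dots> = integral {a..b} (\<lambda>x. w x * \<phi>' n x)"
        by (simp add: integral_open_interval_real)
      also have "\<dots> = integral {a..b} (\<lambda>x. w x * (real n * \<rho> (real n * (x - s))) - w x * (real n * \<rho> (real n * (x - t))))"
        by (simp add: \<phi>'_def right_diff_distrib)
      also have "\<dots> = integral {a..b} (\<lambda>x. w x * (real n * \<rho> (real n * (x - s)))) -
        integral {a..b} (\<lambda>x. w x * (real n * \<rho> (real n * (x - t))))"
        by (intro integral_diff integrable_continuous_real cont)
      finally show ?thesis .
    qed
    moreover have "(\<lambda>n. integral {a..b} (\<lambda>x. w x * (real n * \<rho> (real n * (x - s)))) -
        integral {a..b} (\<lambda>x. w x * (real n * \<rho> (real n * (x - t))))) \<longlonglongrightarrow> w s - w t"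
      using st by (intro tendsto_diff step_kernel_tendsto[OF w _ _ \<Phi>(2,3,6,7)]) auto
    ultimately show ?thesis by simp
  qed
  have lim2: "(\<lambda>n. LINT x:{a<..<b}|lborel. g x * \<phi> n x) \<longlonglongrightarrow> (LINT x:{s<..t}|lborel. g x)"
    unfolding set_lebesgue_integral_def
  proof (rule integral_dominated_convergence)
    have gi: "integrable lborel (\<lambda>x. indicator {a<..<b} x *\<^sub>R g x)"
      using g by (simp add: set_integrable_def)
    then have gm: "(\<lambda>x. indicator {a<..<b} x *\<^sub>R g x) \<in> borel_measurable lborel" by simp
    show "integrable lborel (\<lambda>x. norm (indicator {a<..<b} x *\<^sub>R g x))" using gi by simp
    have "set_integrable lborel {s<..t} g"
      using st by (intro set_integrable_subset[OF g]) auto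
    then show "(\<lambda>x. indicator {s<..t} x *\<^sub>R g x) \<in> borel_measurable lborel"
      by (simp add: set_integrable_def)
    have "(\<lambda>x. (indicator {a<..<b} x *\<^sub>R g x) * \<phi> n x) \<in> borel_measurable lborel" for n
      using gm by (intro borel_measurable_times) auto
    then show "(\<lambda>x. indicator {a<..<b} x *\<^sub>R (g x * \<phi> n x)) \<in> borel_measurable lborel" for n
      by (simp add: mult.assoc)
    have "\<bar>\<phi> n x\<bar> \<le> 1" for n x
      using \<Phi>(4)[of "real n * (x - s)"] \<Phi>(5)[of "real n * (x - s)"]
        \<Phi>(4)[of "real n * (x - t)"] \<Phi>(5)[of "real n * (x - t)"]
      by (simp add: \<phi>_def abs_if)
    then show "AE x in lborel. norm (indicator {a<..<b} x *\<^sub>R (g x * \<phi> n x)) \<le>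
        norm (indicator {a<..<b} x *\<^sub>R g x)" for n
      by (intro AE_I2) (auto simp: indicator_def abs_mult intro: mult_left_le)
    have ev1: "eventually (\<lambda>n. \<Phi> (real n * y) = 1) sequentially" if "y > 0" for y
    proof -
      have "eventually (\<lambda>n. real n \<ge> 1 / y) sequentially"
        using filterlim_real_sequentially by (simp add: filterlim_at_top)
      then show ?thesis
        by eventually_elim (use that in \<open>auto intro!: \<Phi>(7) simp: field_simps\<close>)
    qed
    have ev0: "\<Phi> (real n * y) = 0" if "y \<le> 0" for y n
      using that by (intro \<Phi>(6)) (simp add: mult_nonneg_nonpos)
    \<comment> \<open>Since \<open>\<Phi> 0 = 0\<close>, the limit is 0 at \<open>s\<close> and,
      when \<open>s < t\<close>, 1 at \<open>t\<close>; hence the half-open interval.\<close>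
    have "eventually (\<lambda>n. \<phi> n x = indicator {s<..t} x) sequentially" for x
    proof -
      consider "x \<le> s" | "s < x" "x \<le> t" | "t < x" by linarith
      then show ?thesis
      proof cases
        case 1
        then show ?thesis using st by (simp add: \<phi>_def ev0)
      next
        case 2
        then show ?thesis using ev1[of "x - s"] by (simp add: \<phi>_def ev0)
      next
        case 3
        then show ?thesis using ev1[of "x - s"] ev1[of "x - t"] st
          by (auto simp: \<phi>_def elim: eventually_elim2)
      qed
    qed
    then have "eventually (\<lambda>n. indicator {a<..<b} x *\<^sub>R (g x * \<phi> n x) = indicator {s<..t} x *\<^sub>R g x) sequentially" for x
    proof (rule eventually_mono)
      show "indicator {a<..<b} x *\<^sub>R (g x * \<phi> n x) = indicator {s<..t} x *\<^sub>R g x"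
        if "\<phi> n x = indicator {s<..t} x" for n
        using that st by (auto simp: indicator_def)
    qed
    then show "AE x in lborel. (\<lambda>n. indicator {a<..<b} x *\<^sub>R (g x * \<phi> n x)) \<longlonglongrightarrow> indicator {s<..t} x *\<^sub>R g x"
      by (intro AE_I2 tendsto_eventually)
  qed
  \<comment> \<open>The right flank reaches to \<open>t + 1/n\<close>, so \<open>\<phi> n\<close> is
    an admissible test function only once this is below \<open>b\<close>.\<close>
  have "eventually (\<lambda>n. (LINT x:{a<..<b}|lborel. w x * deriv (\<phi> n) x) =
      - (LINT x:{a<..<b}|lborel. g x * \<phi> n x)) sequentially"
  proof -
    have "eventually (\<lambda>n. inverse (real n) < b - t) sequentially"
      using st by (intro order_tendstoD(2)[OF lim_inverse_n]) auto
    then show ?thesis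
      using eventually_gt_at_top[of 0]
    proof eventually_elim
      case (elim n)
      have "\<phi> n x = 0" if "x \<notin> {s..t + inverse (real n)}" for x
      proof -
        from that consider "x < s" | "x > t + inverse (real n)" by fastforce
        then show ?thesis
        proof cases
          case 1
          then show ?thesis using st by (simp add: \<phi>_def \<Phi>(6) mult_nonneg_nonpos)
        next
          case 2
          then have "real n * inverse (real n) \<le> real n * (x - t)" by (intro mult_left_mono) auto
          then have "1 \<le> real n * (x - t)" using elim by simp
          moreover have "real n * (x - t) \<le> real n * (x - s)" using st by (intro mult_left_mono) auto
          ultimately have "1 \<le> real n * (x - t)" "1 \<le> real n * (x - s)" by linarith+
          then show ?thesis unfolding \<phi>_def by (simp add: \<Phi>(7))
        qed
      qed
      then have "{x. \<phi> n x \<noteq> 0} \<subseteq> {s..t + inverse (real n)}" by blast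
      then have cl: "closure {x. \<phi> n x \<noteq> 0} \<subseteq> {s..t + inverse (real n)}"
        by (intro closure_minimal) auto
      then have "compact (closure {x. \<phi> n x \<noteq> 0})"
        unfolding compact_eq_bounded_closed by (auto intro: bounded_subset[OF bounded_closed_interval])
      moreover have "closure {x. \<phi> n x \<noteq> 0} \<subseteq> {a<..<b}"
        using cl st elim by fastforce
      ultimately have "\<phi> n \<in> test_functions a b"
        using smooth_class_smooth_on[OF \<phi>_smooth] by (simp add: test_functions_def)
      then show ?case using weak by (simp add: has_weak_deriv_def)
    qed
  qed
  then have "(\<lambda>n. - (LINT x:{a<..<b}|lborel. g x * \<phi> n x)) \<longlonglongrightarrow> w s - w t"
    using lim1 by (simp add: tendsto_cong)
  then have "- (LINT x:{s<..t}|lborel. g x) = w s - w t"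
    using tendsto_minus[OF lim2] LIMSEQ_unique by blast
  moreover have "(LINT x:{s<..t}|lborel. g x) = integral {s<..t} g"
    using st by (intro set_borel_integral_eq_integral set_integrable_subset[OF g]) auto
  moreover have "integral {s<..t} g = integral {s..t} g"
    by (rule integral_spike_set) (auto intro: negligible_subset[of "{s}"])
  ultimately show ?thesis by simp
qed

text \<open>\<open>w\<close> minus the indefinite integral of \<open>g\<close> is constant in the
  open interval by the interior case, hence on its closure by continuity. This brings in the
  endpoint \<open>a\<close>, where the fractional derivative starts.\<close>

lemma weak_deriv_ftc:
  assumes w: "continuous_on {a..b} w" and g: "set_integrable lborel {a<..<b} g"
    and weak: "has_weak_deriv a b w g" and st: "a \<le> s" "s \<le> t" "t \<le> b"
  shows "g integrable_on {s..t}" "integral {s..t} g = w t - w s"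
proof -
  have gi: "g integrable_on {a..b}"
    using set_borel_integral_eq_integral(1)[OF g] by (simp add: integrable_on_open_interval_real)
  then show "g integrable_on {s..t}"
    by (rule integrable_on_subinterval) (use st in auto)
  show "integral {s..t} g = w t - w s"
  proof (cases "a < b")
    case True
    define h where "h x = w x - integral {a..x} g" for x
    have cont: "continuous_on (closure {a<..<b}) h"
      using True unfolding h_def
      by (auto intro!: continuous_intros w indefinite_integral_continuous_1 gi)
    define m where "m = (a + b) / 2"
    have m: "a < m" "m < b" using True by (auto simp: m_def)
    have diff: "h x = h y" if "a < x" "x \<le> y" "y < b" for x y
    proof -
      have "integral {a..x} g + integral {x..y} g = integral {a..y} g"
        using that by (intro Henstock_Kurzweil_Integration.integral_combine integrable_on_subinterval[OF gi]) auto
      then show ?thesis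
        using weak_deriv_ftc_interior[OF w g weak that] by (simp add: h_def)
    qed
    have const: "h x = h m" if "x \<in> {a..b}" for x
    proof (rule continuous_constant_on_closure[OF cont])
      show "x \<in> closure {a<..<b}" using that True by simp
      show "h y = h m" if "y \<in> {a<..<b}" for y
      proof (cases "y \<le> m")
        case True
        then show ?thesis using that m by (intro diff) auto
      next
        case False
        then show ?thesis using that m by (intro diff[symmetric]) auto
      qed
    qed
    have "integral {a..s} g + integral {s..t} g = integral {a..t} g"
      using st by (intro Henstock_Kurzweil_Integration.integral_combine integrable_on_subinterval[OF gi]) auto
    then show ?thesis
      using const[of s] const[of t] st by (simp add: h_def)
  next
    case False
    then have "s = t" using st by simp
    then show ?thesis by simp
  qed
qed

section \<open>Comparison principle\<close>

text \<open>On a bounded interval \<open>1 + g^2\<close> is integrable and dominates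
  \<open>\<bar>g\<bar>\<close>.\<close>

lemma square_integrable_imp_set_integrable:
  assumes "square_integrable a b g"
  shows "set_integrable lborel {a<..<b} g"
  unfolding set_integrable_def
proof (rule Bochner_Integration.integrable_bound)
  have "set_integrable lborel {a<..<b} (\<lambda>_. 1 :: real)"
    by (rule set_integrable_subset[OF borel_integrable_atLeastAtMost'[of a b]]) auto
  then show "integrable lborel (\<lambda>x. indicator {a<..<b} x *\<^sub>R (1 + (g x)\<^sup>2))"
    using set_integral_add(1)[of lborel "{a<..<b}" "\<lambda>_. 1" "\<lambda>x. (g x)\<^sup>2"] assms
    by (simp add: square_integrable_def set_integrable_def)
  show "(\<lambda>x. indicator {a<..<b} x *\<^sub>R g x) \<in> borel_measurable lborel"
    using assms by (simp add: square_integrable_def set_borel_measurable_def)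
  have "\<bar>y\<bar> \<le> 1 + y\<^sup>2" for y :: real
  proof -
    have "0 \<le> (\<bar>y\<bar> - 1)\<^sup>2" by simp
    then have "2 * \<bar>y\<bar> \<le> 1 + y\<^sup>2" by (simp add: power2_diff)
    then show ?thesis by linarith
  qed
  then show "AE x in lborel. norm (indicator {a<..<b} x *\<^sub>R g x) \<le> norm (indicator {a<..<b} x *\<^sub>R (1 + (g x)\<^sup>2))"
    by (intro AE_I2) (simp add: abs_mult mult_left_mono)
qed

lemma H1_weak_deriv:
  assumes "u \<in> H1 a b"
  shows "continuous_on {a..b} u" "set_integrable lborel {a<..<b} (weak_deriv a b u)"
    "has_weak_deriv a b u (weak_deriv a b u)"
proof -
  show "continuous_on {a..b} u" using assms by (simp add: H1_def)
  have "\<exists>g. square_integrable a b g \<and> has_weak_deriv a b u g"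
    using assms by (simp add: H1_def)
  then have *: "square_integrable a b (weak_deriv a b u) \<and> has_weak_deriv a b u (weak_deriv a b u)"
    unfolding weak_deriv_def by (rule someI_ex)
  then show "set_integrable lborel {a<..<b} (weak_deriv a b u)"
    by (intro square_integrable_imp_set_integrable) simp
  show "has_weak_deriv a b u (weak_deriv a b u)" using * by simp
qed

text \<open>Monotonicity supplies the measurability of the kernel, and its bound 1 makes
  \<open>g\<close> a majorant.\<close>

lemma set_integrable_mono_mult:
  fixes k g :: "real \<Rightarrow> real"
  assumes "mono_on {a<..<t} k" "\<And>s. s \<in> {a<..<t} \<Longrightarrow> \<bar>k s\<bar> \<le> 1"
    and g: "set_integrable lborel {a<..<t} g"
  shows "set_integrable lborel {a<..<t} (\<lambda>s. k s * g s)"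
  unfolding set_integrable_def
proof (rule Bochner_Integration.integrable_bound)
  show gi: "integrable lborel (\<lambda>x. indicator {a<..<t} x *\<^sub>R g x)"
    using g by (simp add: set_integrable_def)
  have "(\<lambda>x. k x * indicator {a<..<t} x) \<in> borel_measurable borel"
    using borel_measurable_mono_on_fnc[OF assms(1)]
    by (subst (asm) borel_measurable_restrict_space_iff) (auto simp: mult.commute)
  then have "(\<lambda>x. k x * indicator {a<..<t} x) \<in> borel_measurable lborel" by simp
  moreover have "(\<lambda>x. indicator {a<..<t} x *\<^sub>R g x) \<in> borel_measurable lborel"
    using gi by (rule borel_measurable_integrable)
  ultimately have "(\<lambda>x. (k x * indicator {a<..<t} x) * (indicator {a<..<t} x *\<^sub>R g x)) \<in> borel_measurable lborel"
    by (rule borel_measurable_times)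
  moreover have "(\<lambda>x. (k x * indicator {a<..<t} x) * (indicator {a<..<t} x *\<^sub>R g x)) =
      (\<lambda>x. indicator {a<..<t} x *\<^sub>R (k x * g x))"
    by (auto simp: indicator_def)
  ultimately show "(\<lambda>x. indicator {a<..<t} x *\<^sub>R (k x * g x)) \<in> borel_measurable lborel"
    by simp
  show "AE x in lborel. norm (indicator {a<..<t} x *\<^sub>R (k x * g x)) \<le> norm (indicator {a<..<t} x *\<^sub>R g x)"
    using assms(2) by (intro AE_I2) (auto simp: indicator_def abs_mult intro: mult_left_le_one_le)
qed

text \<open>The two derivatives are combined under one integral before the mean value theorem is
  applied, so that a single \<open>c\<close> serves both functions.\<close>

lemma abc_deriv_diff_mean_value:
  assumes \<alpha>: "0 < \<alpha>" "\<alpha> < 1" and t: "a < t" "t < b" and p: "p \<in> H1 a b" and q: "q \<in> H1 a b"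
  shows "\<exists>c\<in>{a..t}. abc_deriv B a b \<alpha> p t - abc_deriv B a b \<alpha> q t =
    B \<alpha> / (1 - \<alpha>) * ((p t - q t) - (p c - q c))"
proof -
  define k where "k s = mittag_leffler \<alpha> (- (\<alpha> / (1 - \<alpha>)) * (t - s) powr \<alpha>)" for s
  define g where "g s = weak_deriv a b p s - weak_deriv a b q s" for s
  have k_mono: "k r \<le> k s" if "r \<le> s" "s \<le> t" for r s
  proof -
    have "(t - s) powr \<alpha> \<le> (t - r) powr \<alpha>"
      using that \<alpha> by (intro powr_mono2) auto
    then show ?thesis
      using mittag_leffler_antimono[OF \<alpha>, of "\<alpha> / (1 - \<alpha>) * (t - s) powr \<alpha>" "\<alpha> / (1 - \<alpha>) * (t - r) powr \<alpha>"] \<alpha>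
      by (simp add: k_def mult_left_mono divide_right_mono)
  qed
  have k_t: "k t = 1" by (simp add: k_def mittag_leffler_0)
  \<comment> \<open>Gives \<open>\<bar>k s\<bar> \<le> 1\<close> before \<open>t\<close>, and keeps
    the kernel increasing when its value at \<open>a\<close> is reset to 0.\<close>
  have k_nonneg: "k s \<ge> 0" for s
    using mittag_leffler_nonneg[OF \<alpha>, of "\<alpha> / (1 - \<alpha>) * (t - s) powr \<alpha>"] \<alpha> by (simp add: k_def)
  have ki: "set_integrable lborel {a<..<t} (\<lambda>s. k s * weak_deriv a b u s)" if "u \<in> H1 a b" for u
  proof (rule set_integrable_mono_mult)
    show "mono_on {a<..<t} k" by (rule mono_onI) (auto intro: k_mono)
    show "\<bar>k s\<bar> \<le> 1" if "s \<in> {a<..<t}" for s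
      using that k_mono[of s t] k_nonneg[of s] k_t by simp
    show "set_integrable lborel {a<..<t} (weak_deriv a b u)"
      by (rule set_integrable_subset[OF H1_weak_deriv(2)[OF that]]) (use t in auto)
  qed
  have gi: "g integrable_on {s..t}" "integral {s..t} g = (p t - q t) - (p s - q s)" if "s \<in> {a..t}" for s
  proof -
    note P = weak_deriv_ftc[OF H1_weak_deriv[OF p], of s t]
    note Q = weak_deriv_ftc[OF H1_weak_deriv[OF q], of s t]
    have i: "weak_deriv a b p integrable_on {s..t}" "weak_deriv a b q integrable_on {s..t}"
      using P(1) Q(1) that t by auto
    show "g integrable_on {s..t}"
      using i unfolding g_def by (rule integrable_diff)
    show "integral {s..t} g = (p t - q t) - (p s - q s)"
      using P(2) Q(2) that t unfolding g_def by (simp add: integral_diff[OF i])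
  qed
  \<comment> \<open>The kernel is increasing; resetting it to \<open>0\<close> at \<open>a\<close> keeps it so and removes the boundary
    term at \<open>a\<close> from the second mean value theorem.\<close>
  obtain c where c: "c \<in> {a..t}" and
    "integral {a..t} (\<lambda>x. (if x \<le> a then 0 else k x) * g x) =
      (if a \<le> a then 0 else k a) * integral {a..c} g + (if t \<le> a then 0 else k t) * integral {c..t} g"
  proof (rule second_mean_value_theorem[of g a t "\<lambda>x. if x \<le> a then 0 else k x"])
    show "g integrable_on {a..t}" "a \<le> t" using gi t by auto
  qed (auto intro: k_mono k_nonneg)
  then have mv: "integral {a..t} (\<lambda>x. (if x \<le> a then 0 else k x) * g x) = (p t - q t) - (p c - q c)"
    using t by (simp add: k_t gi)
  have "(LINT s:{a<..<t}|lborel. k s * weak_deriv a b p s) - (LINT s:{a<..<t}|lborel. k s * weak_deriv a b q s) =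
      (LINT s:{a<..<t}|lborel. k s * g s)"
    using set_integral_diff(2)[OF ki[OF p] ki[OF q]] by (simp add: g_def right_diff_distrib)
  also have "\<dots> = integral {a<..<t} (\<lambda>s. k s * g s)"
    using set_integral_diff(1)[OF ki[OF p] ki[OF q]]
    by (intro set_borel_integral_eq_integral) (simp add: g_def right_diff_distrib)
  \<comment> \<open>On the open interval the reset at \<open>a\<close> is invisible.\<close>
  also have "\<dots> = integral {a<..<t} (\<lambda>x. (if x \<le> a then 0 else k x) * g x)"
    by (intro Henstock_Kurzweil_Integration.integral_cong) auto
  also have "\<dots> = (p t - q t) - (p c - q c)"
    using mv by (simp add: integral_open_interval_real)
  finally show ?thesis
    using c unfolding abc_deriv_def k_def[symmetric] right_diff_distrib[symmetric] by metis
qed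

lemma nonneg_if_increment_bound:
  fixes w :: "real \<Rightarrow> real"
  assumes w: "continuous_on {a..b} w" and "a < b" and lam: "lam < 0" and C: "C \<ge> 0"
    and inc: "\<And>t. t \<in> {a<..<b} \<Longrightarrow> \<exists>c\<in>{a..t}. lam * w t \<le> C * (w t - w c)"
    and t: "t \<in> {a..b}"
  shows "w t \<ge> 0"
proof (rule continuous_ge_on_closure[of "{a<..<b}" w])
  show "continuous_on (closure {a<..<b}) w" "t \<in> closure {a<..<b}"
    using w t \<open>a < b\<close> by auto
  fix t1 assume t1: "t1 \<in> {a<..<b}"
  show "w t1 \<ge> 0"
  proof (rule ccontr)
    assume neg: "\<not> w t1 \<ge> 0"
    \<comment> \<open>Minimising over \<open>{a..t1}\<close> keeps \<open>t0\<close> below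
      \<open>b\<close>, where \<open>inc\<close> applies, and covers every
      \<open>c \<in> {a..t0}\<close>.\<close>
    obtain t0 where t0: "t0 \<in> {a..t1}" and min: "\<And>s. s \<in> {a..t1} \<Longrightarrow> w t0 \<le> w s"
      using continuous_attains_inf[of "{a..t1}" w] t1 w continuous_on_subset[of "{a..b}" w "{a..t1}"] by fastforce
    have "w t0 < 0" using min[of t1] neg t1 by auto
    then have pos: "lam * w t0 > 0" using lam by (simp add: mult_neg_neg)
    show False
    proof (cases "t0 = a")
      case False
      then obtain c where c: "c \<in> {a..t0}" "lam * w t0 \<le> C * (w t0 - w c)"
        using inc[of t0] t0 t1 by auto
      have "C * (w t0 - w c) \<le> 0"
        using min[of c] c t0 C by (intro mult_nonneg_nonpos) auto
      then show False using c pos by simp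
    next
      case True
      \<comment> \<open>Chosen so that \<open>2 * C * e = lam * (w a + e)\<close>: within
        \<open>e\<close> of \<open>w a\<close>, the right side of \<open>inc\<close> is at most the
        former and the left side exceeds the latter.\<close>
      define e where "e = lam * w a / (2 * C - lam)"
      have e: "e > 0" "e * (2 * C - lam) = lam * w a"
        using pos True lam C by (auto simp: e_def)
      obtain d where d: "d > 0" "\<And>x. x \<in> {a..b} \<Longrightarrow> dist x a < d \<Longrightarrow> dist (w x) (w a) < e"
        using w \<open>a < b\<close> e(1) unfolding continuous_on_iff by (metis atLeastAtMost_iff less_eq_real_def)
      define t2 where "t2 = a + min d (b - a) / 2"
      have t2: "a < t2" "t2 < b" "t2 < a + d"
        using d \<open>a < b\<close> by (auto simp: t2_def min_def field_simps)
      obtain c where c: "c \<in> {a..t2}" "lam * w t2 \<le> C * (w t2 - w c)"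
        using inc[of t2] t2 by auto
      have near: "\<bar>w t2 - w a\<bar> < e" "\<bar>w c - w a\<bar> < e"
        using d(2)[of t2] d(2)[of c] c t2 by (auto simp: dist_real_def)
      have "C * (w t2 - w c) \<le> C * (2 * e)"
        using near C by (intro mult_left_mono) auto
      moreover have "lam * (w a + e) < lam * w t2"
        using near lam by (intro mult_strict_left_mono_neg) auto
      ultimately show False
        using c e(2) by (simp add: algebra_simps)
    qed
  qed
qed

lemma abc_deriv_comparison:
  assumes B: "normalization_function B" and "a < b" and \<alpha>: "0 < \<alpha>" "\<alpha> < 1" and lam: "lam < 0"
    and p: "p \<in> H1 a b" and q: "q \<in> H1 a b"
    and le: "\<And>t. t \<in> {a<..<b} \<Longrightarrow>
      lam * (p t - q t) \<le> abc_deriv B a b \<alpha> p t - abc_deriv B a b \<alpha> q t"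
    and t: "t \<in> {a..b}"
  shows "q t \<le> p t"
proof -
  have "p t - q t \<ge> 0"
  proof (rule nonneg_if_increment_bound[of a b "\<lambda>s. p s - q s" lam "B \<alpha> / (1 - \<alpha>)"])
    show "continuous_on {a..b} (\<lambda>s. p s - q s)"
      using H1_weak_deriv(1)[OF p] H1_weak_deriv(1)[OF q] by (rule continuous_on_diff)
    show "B \<alpha> / (1 - \<alpha>) \<ge> 0"
      using B \<alpha> by (auto simp: normalization_function_def intro: less_imp_le)
    show "\<exists>c\<in>{a..s}. lam * (p s - q s) \<le> B \<alpha> / (1 - \<alpha>) * (p s - q s - (p c - q c))"
      if "s \<in> {a<..<b}" for s
      using abc_deriv_diff_mean_value[OF \<alpha>, of a s b p q B] le[OF that] that p q by auto
  qed (use assms in auto)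
  then show ?thesis by simp
qed

theorem lemma4p2:
  fixes a b \<alpha> lam1 lam2 :: real
    and B h1 h2 u v1 v2 :: "real \<Rightarrow> real"
    and f :: "real \<times> real \<Rightarrow> real"
  assumes "normalization_function B"
    and "a < b" and "0 < \<alpha>" and "\<alpha> < 1"
    and "smooth_on ({a..b} \<times> UNIV) f"
    and "lam1 < 0" and "lam2 < 0"
    and "\<And>t w. t \<in> {a<..<b} \<Longrightarrow> w \<in> H1 a b \<Longrightarrow>
           lam2 * w t + h2 t \<le> f (t, w t) \<and> f (t, w t) \<le> lam1 * w t + h1 t"
    and "u \<in> H1 a b"
    and "\<And>t. t \<in> {a<..b} \<Longrightarrow> abc_deriv B a b \<alpha> u t = f (t, u t)"
    and "v1 \<in> H1 a b"
    and "\<And>t. t \<in> {a<..b} \<Longrightarrow> abc_deriv B a b \<alpha> v1 t = lam1 * v1 t + h1 t"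
    and "v2 \<in> H1 a b"
    and "\<And>t. t \<in> {a<..b} \<Longrightarrow> abc_deriv B a b \<alpha> v2 t = lam2 * v2 t + h2 t"
  shows "\<forall>t\<in>{a..b}. v2 t \<le> u t \<and> u t \<le> v1 t"
proof (intro ballI conjI)
  fix t assume t: "t \<in> {a..b}"
  show "v2 t \<le> u t"
  proof (rule abc_deriv_comparison[OF assms(1-4,7) assms(9,13) _ t])
    \<comment> \<open>The bounds on \<open>f\<close> are used with \<open>w = u\<close>; in the
      difference \<open>h2\<close> cancels.\<close>
    fix s assume s: "s \<in> {a<..<b}"
    then show "lam2 * (u s - v2 s) \<le> abc_deriv B a b \<alpha> u s - abc_deriv B a b \<alpha> v2 s"
      using assms(8)[OF s assms(9)] assms(10)[of s] assms(14)[of s] by (simp add: right_diff_distrib)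
  qed
  show "u t \<le> v1 t"
  proof (rule abc_deriv_comparison[OF assms(1-4,6) assms(11,9) _ t])
    \<comment> \<open>The upper bound on \<open>f\<close> makes \<open>v1 - u\<close> the difference
      to be shown nonnegative, with \<open>h1\<close> cancelling.\<close>
    fix s assume s: "s \<in> {a<..<b}"
    then show "lam1 * (v1 s - u s) \<le> abc_deriv B a b \<alpha> v1 s - abc_deriv B a b \<alpha> u s"
      using assms(8)[OF s assms(9)] assms(10)[of s] assms(12)[of s] by (simp add: right_diff_distrib)
  qed
qed

end
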